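(* Let $n\ge 5$ be an integer. Every $n\times n$ non-split binary matrix $\mathcal M$ with $|\operatorname{disc}(\mathcal M)|\le n$ contains a zero-sum square. In particular, every $n\times n$ binary matrix $\mathcal M$ with $\operatorname{disc}(\mathcal M)=0$ contains a zero-sum square.
   Context: A binary matrix is a matrix with entries in $\{-1,1\}$. For a binary matrix $\mathcal M=(a_{i,j})$, its discrepancy $\operatorname{disc}(\mathcal M)$ is the sum of all its entries. A square in an $n\times m$ matrix $\mathcal M=(a_{i,j})$ is a $2\times 2$ sub-matrix of the form $\begin{pmatrix} a_{i,j} & a_{i,j+s}\\ a_{i+s,j} & a_{i+s,j+s}\end{pmatrix}$ for some positive integer $s$ (with $1\le i$, $i+s\le n$, $1\le j$, $j+s\le m$). A zero-sum square is a square whose four entries sum to $0$. An $n\times m$ binary matrix $\mathcal M=(a_{i,j})$ is called $t$-split if, for an integer $t$ with $0\le t<n+m$, one has $a_{i,j}=-1$ if $i+j\le t+1$ and $a_{i,j}=1$ otherwise. A binary matrix $\mathcal M$ is called split if either $\mathcal M$, its negative $-\mathcal M$, its horizontal reflection, or its vertical reflection is $t$-split for some $t$; otherwise it is non-split. *)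

theory Defs
  imports "Jordan_Normal_Form.Matrix"
begin

text \<open>Matrix indices are 0-based: the entry in row \<open>i\<close> and column \<open>j\<close> of the usual
  1-based numbering is \<open>M $$ (i - 1, j - 1)\<close>.\<close>

definition binary_mat :: "int mat \<Rightarrow> bool" where
  "binary_mat M \<longleftrightarrow> elements_mat M \<subseteq> {-1, 1}"

definition disc :: "int mat \<Rightarrow> int" where
  "disc M = sum_mat M"

definition has_zero_sum_square :: "int mat \<Rightarrow> bool" where
  "has_zero_sum_square M \<longleftrightarrow>
    (\<exists>i j s. 0 < s \<and> i + s < dim_row M \<and> j + s < dim_col M \<and>
       M $$ (i, j) + M $$ (i, j + s) + M $$ (i + s, j) + M $$ (i + s, j + s) = 0)"

text \<open>The condition \<open>Suc i + Suc j \<le> t + 1\<close> is the 1-based condition \<open>i + j \<le> t + 1\<close>.\<close>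

definition t_split :: "nat \<Rightarrow> int mat \<Rightarrow> bool" where
  "t_split t M \<longleftrightarrow> t < dim_row M + dim_col M \<and>
    (\<forall>i < dim_row M. \<forall>j < dim_col M.
       M $$ (i, j) = (if Suc i + Suc j \<le> t + 1 then -1 else 1))"

definition horizontal_reflection :: "'a mat \<Rightarrow> 'a mat" where
  "horizontal_reflection M =
    mat (dim_row M) (dim_col M) (\<lambda>(i, j). M $$ (i, dim_col M - 1 - j))"

definition vertical_reflection :: "'a mat \<Rightarrow> 'a mat" where
  "vertical_reflection M =
    mat (dim_row M) (dim_col M) (\<lambda>(i, j). M $$ (dim_row M - 1 - i, j))"

definition split_binary_mat :: "int mat \<Rightarrow> bool" where
  "split_binary_mat M \<longleftrightarrow>
    (\<exists>t. t_split t M \<or> t_split t (- M) \<or>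
       t_split t (horizontal_reflection M) \<or> t_split t (vertical_reflection M))"

end

theory Submission
  imports Defs
begin

text \<open>
A zero-sum square is avoided in a very rigid way next to a staircase, the boundary of a region of
\<open>-1\<close>s cut off by an antidiagonal. If a \<open>b \<times> b\<close> block is \<open>-1\<close> exactly in the cells with \<open>i + j < t\<close>
(counting from \<open>0\<close>) and \<open>t \<le> b < 3 t / 2\<close>, then any further line next to it is determined: a square
with one upper corner on each side of the staircase forces its two lower corners to be equal, and a
square with both upper corners \<open>1\<close> forbids two lower corners \<open>-1\<close> (\<open>staircase_next_row\<close>).

The proof is by induction on \<open>n\<close>. Put \<open>k = n div 2\<close> and look at the blocks of size \<open>k + 1\<close>.

Suppose first that one of them has a sum of absolute value at most \<open>k + 1\<close>. By induction it is a
staircase along its main diagonal or antidiagonal. The rigidity lets it grow in both directions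
along that diagonal until it sits in a corner of the array (\<open>staircase_slide_to_corner\<close>), and then
away from the corner until it has size \<open>3 t / 2\<close>. Either it fills the array by then, so that the
array is split, or, up to a symmetry, the few lines outside the block cannot make up for the
surplus of \<open>1\<close>s inside it, and the total sum exceeds \<open>n\<close> (\<open>block_sum_large_of_corner_staircase\<close>).

Otherwise all these blocks have a sum of absolute value above \<open>k + 1\<close>. Moving a block by one line
changes its sum by at most \<open>2 (k + 1)\<close>, so all these sums have the same sign, say positive. A block
of size \<open>k\<close> lies in a block of size \<open>k + 1\<close> with \<open>2 k + 1\<close> further entries, so its sum exceeds
\<open>-k\<close>; by induction it is then at least \<open>k\<close>. The blocks of sizes \<open>k\<close> and \<open>k + 1\<close> in the four corners
now show that the total sum exceeds \<open>n\<close> (\<open>block_sum_large_of_blocks\<close>).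

The induction starts with an exhaustive search for \<open>n = 5, 6, 7\<close>. The cases \<open>n = 8, 9\<close> also involve
blocks of size \<open>4\<close>, for which the theorem fails, since there are zero-sum-free \<open>4 \<times> 4\<close> arrays with
sum \<open>0\<close>; none of them can be continued by a fifth row, which is again found by search.

A zero-sum-free array of small sum is therefore a staircase along a main diagonal, and its sum is
\<open>n\<close> or \<open>-n\<close>. This gives both parts of the theorem.
\<close>

section \<open>Zero-sum-free arrays and their symmetries\<close>

text \<open>
Arrays are functions on \<open>nat \<times> nat\<close> of which only a top left rectangle matters. This lets blocks of
different sizes and positions be compared by \<open>shift\<close>, without a change of type or carrier.
\<close>

definition zero_sum_free :: "nat \<Rightarrow> nat \<Rightarrow> (nat \<Rightarrow> nat \<Rightarrow> int) \<Rightarrow> bool" where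
  "zero_sum_free R C a \<longleftrightarrow> (\<forall>i<R. \<forall>j<C. a i j = 1 \<or> a i j = -1) \<and>
     (\<forall>i j s. 0 < s \<and> i + s < R \<and> j + s < C \<longrightarrow>
        a i j + a i (j + s) + a (i + s) j + a (i + s) (j + s) \<noteq> 0)"

definition block_sum :: "nat \<Rightarrow> (nat \<Rightarrow> nat \<Rightarrow> int) \<Rightarrow> int" where
  "block_sum n a = (\<Sum>i<n. \<Sum>j<n. a i j)"

lemma zero_sum_free_entry: "zero_sum_free R C a \<Longrightarrow> i < R \<Longrightarrow> j < C \<Longrightarrow> a i j = 1 \<or> a i j = -1"
  by (simp add: zero_sum_free_def)

lemma zero_sum_free_square:
  "zero_sum_free R C a \<Longrightarrow> 0 < s \<Longrightarrow> i + s < R \<Longrightarrow> j + s < C \<Longrightarrow>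
   a i j + a i (j + s) + a (i + s) j + a (i + s) (j + s) \<noteq> 0"
  by (simp add: zero_sum_free_def)

definition staircase :: "nat \<Rightarrow> nat \<Rightarrow> (nat \<Rightarrow> nat \<Rightarrow> int) \<Rightarrow> bool" where
  "staircase t n a \<longleftrightarrow> (\<forall>i<n. \<forall>j<n. a i j = (if i + j < t then -1 else 1))"

definition flip :: "nat \<Rightarrow> (nat \<Rightarrow> nat \<Rightarrow> int) \<Rightarrow> nat \<Rightarrow> nat \<Rightarrow> int" where
  "flip n a = (\<lambda>i j. a i (n - 1 - j))"

definition neg :: "(nat \<Rightarrow> nat \<Rightarrow> int) \<Rightarrow> nat \<Rightarrow> nat \<Rightarrow> int" where
  "neg a = (\<lambda>i j. - a i j)"

text \<open>
These are the split arrays whose boundary runs along a main diagonal or antidiagonal. Among all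
split arrays exactly they have a sum of absolute value at most \<open>n\<close>. Together, \<open>neg\<close> and \<open>flip\<close>
account for the four possible corners of the region of \<open>-1\<close>s, because the negative of a staircase
is a staircase in the opposite corner.
\<close>
definition main_split :: "nat \<Rightarrow> (nat \<Rightarrow> nat \<Rightarrow> int) \<Rightarrow> bool" where
  "main_split n a \<longleftrightarrow> (\<exists>t\<in>{n - 1, n}. staircase t n a \<or> staircase t n (neg a) \<or>
     staircase t n (flip n a) \<or> staircase t n (neg (flip n a)))"

definition shift :: "nat \<Rightarrow> nat \<Rightarrow> (nat \<Rightarrow> nat \<Rightarrow> int) \<Rightarrow> nat \<Rightarrow> nat \<Rightarrow> int" where
  "shift p q a = (\<lambda>i j. a (p + i) (q + j))"

definition transp :: "(nat \<Rightarrow> nat \<Rightarrow> int) \<Rightarrow> nat \<Rightarrow> nat \<Rightarrow> int" where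
  "transp a = (\<lambda>i j. a j i)"

definition rot :: "nat \<Rightarrow> (nat \<Rightarrow> nat \<Rightarrow> int) \<Rightarrow> nat \<Rightarrow> nat \<Rightarrow> int" where
  "rot n a = (\<lambda>i j. a (n - 1 - i) (n - 1 - j))"

lemma zero_sum_freeI:
  assumes "\<And>i j. i < R \<Longrightarrow> j < C \<Longrightarrow> a i j = 1 \<or> a i j = -1"
    and "\<And>i j s. 0 < s \<Longrightarrow> i + s < R \<Longrightarrow> j + s < C \<Longrightarrow>
           a i j + a i (j + s) + a (i + s) j + a (i + s) (j + s) \<noteq> 0"
  shows "zero_sum_free R C a"
  using assms by (simp add: zero_sum_free_def)

lemma zero_sum_free_neg: "zero_sum_free R C a \<Longrightarrow> zero_sum_free R C (neg a)"
proof (rule zero_sum_freeI)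
  fix i j s assume *: "zero_sum_free R C a" "0 < s" "i + s < R" "j + s < C"
  show "neg a i j + neg a i (j + s) + neg a (i + s) j + neg a (i + s) (j + s) \<noteq> 0"
    using zero_sum_free_square[OF *] by (simp add: neg_def)
qed (auto simp: neg_def dest: zero_sum_free_entry)

lemma zero_sum_free_shift: "zero_sum_free R C a \<Longrightarrow> p + R' \<le> R \<Longrightarrow> q + C' \<le> C \<Longrightarrow>
    zero_sum_free R' C' (shift p q a)"
proof (rule zero_sum_freeI)
  fix i j s assume *: "zero_sum_free R C a" "p + R' \<le> R" "q + C' \<le> C" "0 < s" "i + s < R'"
      "j + s < C'"
  show "shift p q a i j + shift p q a i (j + s) + shift p q a (i + s) j
      + shift p q a (i + s) (j + s) \<noteq> 0"
    using zero_sum_free_square[OF *(1,4), of "p + i" "q + j"] * by (simp add: shift_def add.assoc)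
qed (use zero_sum_free_entry[of R C a] in \<open>auto simp: shift_def\<close>)

lemma zero_sum_free_transp: "zero_sum_free R C a \<Longrightarrow> zero_sum_free C R (transp a)"
proof (rule zero_sum_freeI)
  fix i j s assume *: "zero_sum_free R C a" "0 < s" "i + s < C" "j + s < R"
  show "transp a i j + transp a i (j + s) + transp a (i + s) j + transp a (i + s) (j + s) \<noteq> 0"
    using zero_sum_free_square[OF *(1,2,4,3)] by (simp add: transp_def)
qed (use zero_sum_free_entry[of R C a] in \<open>auto simp: transp_def\<close>)

lemma zero_sum_free_flip: "zero_sum_free R n a \<Longrightarrow> zero_sum_free R n (flip n a)"
proof (rule zero_sum_freeI)
  fix i j s assume *: "zero_sum_free R n a" "0 < s" "i + s < R" "j + s < n"
  have "n - 1 - (j + s) + s = n - 1 - j" using * by simp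
  then show "flip n a i j + flip n a i (j + s) + flip n a (i + s) j + flip n a (i + s) (j + s) \<noteq> 0"
    using zero_sum_free_square[OF *(1-3), of "n - 1 - (j + s)"] * by (simp add: flip_def)
next
  fix i j assume "zero_sum_free R n a" "i < R" "j < n"
  then show "flip n a i j = 1 \<or> flip n a i j = -1"
    using zero_sum_free_entry[of R n a i "n - 1 - j"] by (simp add: flip_def)
qed

lemma rot_eq: "rot n a = transp (flip n (transp (flip n a)))"
  by (simp add: rot_def transp_def flip_def)

lemma zero_sum_free_rot: "zero_sum_free n n a \<Longrightarrow> zero_sum_free n n (rot n a)"
  unfolding rot_eq by (intro zero_sum_free_flip zero_sum_free_transp)

lemma block_sum_neg: "block_sum n (neg a) = - block_sum n a"
  by (simp add: block_sum_def neg_def sum_negf)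

lemma block_sum_transp: "block_sum n (transp a) = block_sum n a"
  unfolding block_sum_def transp_def by (rule sum.swap)

lemma block_sum_flip: "block_sum n (flip n a) = block_sum n a"
proof -
  have "(\<Sum>j<n. flip n a i j) = (\<Sum>j<n. a i j)" for i
    using sum.nat_diff_reindex[of "a i" n] by (simp add: flip_def)
  then show ?thesis by (simp add: block_sum_def)
qed

lemma block_sum_rot: "block_sum n (rot n a) = block_sum n a"
  by (simp add: rot_eq block_sum_transp block_sum_flip)

lemma block_sum_cong: "(\<And>i j. i < n \<Longrightarrow> j < n \<Longrightarrow> a i j = b i j) \<Longrightarrow> block_sum n a = block_sum n b"
  unfolding block_sum_def by (intro sum.cong refl) auto

lemma block_sum_Suc: "block_sum (Suc n) a = block_sum n a + (\<Sum>j<n. a n j) + (\<Sum>i<n. a i n) + a n n"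
  by (simp add: block_sum_def sum.distrib)

lemma staircase_transp: "staircase t n (transp a) \<longleftrightarrow> staircase t n a"
  by (auto simp: staircase_def transp_def add.commute)

section \<open>Propagation of a staircase\<close>

text \<open>
Write \<open>x\<^sub>l\<close> for the entry \<open>a b l\<close> of the new row. For \<open>l < v\<close> the square with lower corners \<open>x\<^sub>l\<close>
and \<open>x\<^sub>v\<close> has upper corners in row \<open>b - (v - l)\<close>. The left one is \<open>-1\<close> if \<open>b + 2 l < t + v\<close>, and
the right one is \<open>1\<close> because it lies on the antidiagonal of \<open>x\<^sub>l\<close>; in that case \<open>x\<^sub>l = x\<^sub>v\<close>. Taking
\<open>v = b - 1\<close> handles the small \<open>l\<close>, taking the left corner in column \<open>0\<close> handles the large \<open>v\<close>, and
\<open>2 b + 2 \<le> 3 t\<close> says that no column is missed. So the row is constant, and the two \<open>1\<close>s above its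
end exclude \<open>-1\<close>.
\<close>
lemma staircase_next_row:
  assumes z: "zero_sum_free (Suc b) b a" and st: "staircase t b a"
    and t: "t \<le> b" "2 * b + 2 \<le> 3 * t" "3 \<le> b" and j: "j < b"
  shows "a b j = 1"
proof -
  have top: "a i l = (if i + l < t then -1 else 1)" if "i < b" "l < b" for i l
    using st that by (simp add: staircase_def)
  have entry: "a b l = 1 \<or> a b l = -1" if "l < b" for l
    using zero_sum_free_entry[OF z] that by simp
  have eq: "a b l = a b v" if "l < v" "v < b" "b + 2 * l < t + v" for l v
  proof -
    define s where "s = v - l"
    then have s: "v = l + s" "0 < s" using that(1) by auto
    have i: "b - s + s = b" "b - s < b" using s that by auto
    have "a (b - s) l + a (b - s) (l + s) + a b l + a b (l + s) \<noteq> 0"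
      using zero_sum_free_square[OF z s(2), of "b - s" l] i that s by simp
    moreover have "a (b - s) l = -1" "a (b - s) (l + s) = 1"
      using top[of "b - s" l] top[of "b - s" "l + s"] i that s t by auto
    ultimately show ?thesis using entry[of l] entry[of v] that s by auto
  qed
  have last: "a b l = a b (b - 1)" if "l < b" for l
  proof (cases "2 * l + 1 < t")
    case True
    show ?thesis
    proof (cases "l = b - 1")
      case False
      then show ?thesis using eq[of l "b - 1"] True that by simp
    qed simp
  next
    case False
    then have "a b 0 = a b l" using eq[of 0 l] that t by linarith
    moreover have "a b 0 = a b (b - 1)" using eq[of 0 "b - 1"] t by simp
    ultimately show ?thesis by simp
  qed
  have "a (b - 1) (b - 2) = 1" "a (b - 1) (b - 1) = 1"
    using top[of "b - 1" "b - 2"] top[of "b - 1" "b - 1"] t by auto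
  moreover have "a (b - 1) (b - 2) + a (b - 1) (b - 2 + 1)
      + a (b - 1 + 1) (b - 2) + a (b - 1 + 1) (b - 2 + 1) \<noteq> 0"
    by (rule zero_sum_free_square[OF z]) (use t in auto)
  moreover have "b - 2 + 1 = b - 1" "b - 1 + 1 = b" using t by auto
  ultimately have "\<not> (a b (b - 2) = -1 \<and> a b (b - 1) = -1)" by auto
  moreover have "a b (b - 2) = a b (b - 1)" using last[of "b - 2"] t by simp
  ultimately show ?thesis using last[OF j] entry[OF j] by auto
qed

lemma staircase_extend:
  assumes z: "zero_sum_free (Suc b) (Suc b) a" and st: "staircase t b a"
    and t: "t \<le> b" "2 * b + 2 \<le> 3 * t" "3 \<le> b"
  shows "staircase t (Suc b) a"
proof -
  have row: "a b j = 1" if "j < b" for j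
    using staircase_next_row[OF _ st t that] zero_sum_free_shift[OF z, of 0 "Suc b" 0 b]
      by (simp add: shift_def)
  have "zero_sum_free (Suc b) b (transp a)"
    using zero_sum_free_transp[OF zero_sum_free_shift[OF z, of 0 b 0 "Suc b"]]
      by (simp add: shift_def)
  then have col: "a i b = 1" if "i < b" for i
    using staircase_next_row[of b "transp a" t i] st t that
      by (simp add: staircase_transp) (simp add: transp_def)
  have "a 0 0 = -1" using st t by (auto simp: staircase_def)
  then have "a b b = 1"
    using zero_sum_free_square[OF z, of b 0 0]
      zero_sum_free_entry[OF z, of b b] row[of 0] col[of 0] t by auto
  then show ?thesis
    using st row col t by (auto simp: staircase_def less_Suc_eq)
qed

text \<open>
Reflection in the antidiagonal together with negation preserves the staircases and turns the column
to the left of a block into the row below it.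
\<close>
lemma zero_sum_free_neg_antitransp: "zero_sum_free m (Suc m) a \<Longrightarrow>
    zero_sum_free (Suc m) m (\<lambda>i j. - a (m - 1 - j) (m - i))"
  using zero_sum_free_neg[OF zero_sum_free_flip[OF zero_sum_free_transp[OF zero_sum_free_flip]], of m "Suc m" a]
  by (simp add: neg_def flip_def transp_def)

text \<open>
The staircase along the main antidiagonal continues beyond the lower left corner of its block: the
row below consists of \<open>1\<close>s, the column to the left of \<open>-1\<close>s, and the unit square in the corner then
decides the last cell.
\<close>
lemma staircase_slide_down_left:
  assumes z: "zero_sum_free (Suc m) (Suc m) a" and st: "staircase t m (shift 0 1 a)"
    and t: "t \<in> {m - 1, m}" and m: "5 \<le> m"
  shows "staircase (Suc t) (Suc m) a"
proof -
  have old: "a i (Suc j) = (if i + j < t then -1 else 1)" if "i < m" "j < m" for i j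
    using st that by (simp add: staircase_def shift_def)
  have t': "t \<le> m" "2 * m + 2 \<le> 3 * t" using t m by auto
  have row: "a m (Suc j) = 1" if "j < m" for j
    using staircase_next_row[OF zero_sum_free_shift[OF z] st t' _ that] m by (simp add: shift_def)
  define b where "b = (\<lambda>i j. - a (m - 1 - j) (m - i))"
  have "zero_sum_free (Suc m) m b"
    unfolding b_def using zero_sum_free_neg_antitransp zero_sum_free_shift[OF z, of 0 m 0 "Suc m"]
      by (simp add: shift_def)
  moreover have "staircase (2 * m - 1 - t) m b"
    unfolding staircase_def
  proof (intro allI impI)
    fix i j assume ij: "i < m" "j < m"
    have "b i j = - a (m - 1 - j) (Suc (m - 1 - i))" using ij by (simp add: b_def Suc_diff_Suc)
    then show "b i j = (if i + j < 2 * m - 1 - t then -1 else 1)"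
      using old[of "m - 1 - j" "m - 1 - i"] ij t' by auto
  qed
  moreover have "2 * m - 1 - t \<le> m" "2 * m + 2 \<le> 3 * (2 * m - 1 - t)" using t m by auto
  ultimately have "b m j = 1" if "j < m" for j
    using staircase_next_row[of m b "2 * m - 1 - t" j] that m by simp
  then have col: "a i 0 = -1" if "i < m" for i
    using that by (auto simp: b_def dest!: meta_spec[of _ "m - 1 - i"])
  have "a (m - 1) 0 + a (m - 1) (0 + 1) + a (m - 1 + 1) 0 + a (m - 1 + 1) (0 + 1) \<noteq> 0"
    by (rule zero_sum_free_square[OF z]) (use m in auto)
  then have "a m 0 = (if m < Suc t then -1 else 1)"
    using zero_sum_free_entry[OF z, of m 0] row[of 0] col[of "m - 1"] old[of "m - 1" 0] t m
    by (auto split: if_splits)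
  then have "a i j = (if i + j < Suc t then -1 else 1)" if "i < Suc m" "j < Suc m" for i j
    using that old[of i "j - 1"] row[of "j - 1"] col[of i] t
    by (cases j; cases "i = m") (auto split: if_splits)
  then show ?thesis by (simp add: staircase_def)
qed

lemma staircase_slide_up_right:
  assumes z: "zero_sum_free (Suc m) (Suc m) a" and st: "staircase t m (shift 1 0 a)"
    and t: "t \<in> {m - 1, m}" and m: "5 \<le> m"
  shows "staircase (Suc t) (Suc m) a"
proof -
  have "shift 0 1 (transp a) = transp (shift 1 0 a)" by (simp add: shift_def transp_def)
  then have "staircase (Suc t) (Suc m) (transp a)"
    using staircase_slide_down_left[OF zero_sum_free_transp[OF z] _ t m] st
      by (simp add: staircase_transp)
  then show ?thesis by (simp add: staircase_transp)
qed

text \<open>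
A block that cannot grow down-left or up-right touches one side of the array in each of the two
directions. Unless it is the whole array, these sides meet in the top left or the bottom right
corner. In the second case a half turn and a negation bring the staircase to the top left.
\<close>
lemma staircase_slide_to_corner:
  assumes "zero_sum_free n n a" "staircase t m (shift p q a)" "t \<in> {m - 1, m}" "5 \<le> m" "p + m \<le> n"
      "q + m \<le> n"
  shows "\<exists>m' t'. m \<le> m' \<and> m' \<le> n \<and> t' \<in> {m' - 1, m'} \<and>
           (staircase t' m' a \<or> staircase t' m' (neg (rot n a)))"
  using assms(2-6)
proof (induction "n - m" arbitrary: m p q t rule: less_induct)
  case less
  have Suct: "Suc t \<in> {Suc m - 1, Suc m}" using less.prems by auto
  show ?case
  proof (cases "0 < q \<and> p + m < n")
    case True
    then have "shift 0 1 (shift p (q - 1) a) = shift p q a" by (auto simp: shift_def)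
    then have "staircase (Suc t) (Suc m) (shift p (q - 1) a)"
      using staircase_slide_down_left[OF zero_sum_free_shift[OF assms(1)] _ less.prems(2,3)] less.prems True by simp
    then have "\<exists>m' t'. Suc m \<le> m' \<and> m' \<le> n \<and> t' \<in> {m' - 1, m'} \<and>
           (staircase t' m' a \<or> staircase t' m' (neg (rot n a)))"
      by (intro less.hyps[OF _ _ Suct]) (use less.prems True in auto)
    then show ?thesis using Suc_leD by blast
  next
    case nleft: False
    show ?thesis
    proof (cases "0 < p \<and> q + m < n")
      case True
      then have "shift 1 0 (shift (p - 1) q a) = shift p q a" by (auto simp: shift_def)
      then have "staircase (Suc t) (Suc m) (shift (p - 1) q a)"
        using staircase_slide_up_right[OF zero_sum_free_shift[OF assms(1)] _ less.prems(2,3)] less.prems True by simp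
      then have "\<exists>m' t'. Suc m \<le> m' \<and> m' \<le> n \<and> t' \<in> {m' - 1, m'} \<and>
           (staircase t' m' a \<or> staircase t' m' (neg (rot n a)))"
        by (intro less.hyps[OF _ _ Suct]) (use less.prems True in auto)
      then show ?thesis using Suc_leD by blast
    next
      case False
      then consider "p = 0" "q = 0" | "p = n - m" "q = n - m"
        using nleft less.prems by linarith
      then show ?thesis
      proof cases
        case 1
        then have "staircase t m a" using less.prems by (simp add: shift_def)
        then show ?thesis
          using less.prems by (intro exI[of _ m] exI[of _ t]) simp
      next
        case 2
        have "neg (rot n a) i j = (if i + j < 2 * m - 1 - t then -1 else 1)"
          if "i < m" "j < m" for i j
        proof -
          have "p + (m - 1 - i) = n - 1 - i" "q + (m - 1 - j) = n - 1 - j"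
            using 2 that less.prems by auto
          then have "neg (rot n a) i j = - shift p q a (m - 1 - i) (m - 1 - j)"
            using 2 that less.prems by (simp add: neg_def rot_def shift_def)
          also have "\<dots> = (if i + j < 2 * m - 1 - t then -1 else 1)"
            using less.prems(1,2) that by (auto simp: staircase_def)
          finally show ?thesis .
        qed
        then have "staircase (2 * m - 1 - t) m (neg (rot n a))" by (simp add: staircase_def)
        moreover have "2 * m - 1 - t \<in> {m - 1, m}" using less.prems by auto
        ultimately show ?thesis
          using less.prems by (intro exI[of _ m] exI[of _ "2 * m - 1 - t"]) simp
      qed
    qed
  qed
qed

section \<open>The sum of an array with a staircase in a corner\<close>

lemma sum_linear_staircase: "t \<le> n \<Longrightarrow> (\<Sum>i<n. int (t - i)) * 2 = int t * (int t + 1)"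
proof (induction rule: dec_induct)
  case base
  define S where "S = (\<lambda>t. \<Sum>i<t. int (t - i))"
  have step: "S (Suc t) = S t + int t + 1" for t
  proof -
    have "(\<Sum>i<t. int (Suc t - i)) = (\<Sum>i<t. int (t - i) + 1)"
      by (intro sum.cong refl) auto
    then show ?thesis unfolding S_def sum.lessThan_Suc by (simp only: sum.distrib) simp
  qed
  have "S t * 2 = int t * (int t + 1)"
    by (induction t) (simp_all add: step algebra_simps, simp add: S_def)
  then show ?case by (simp only: S_def)
qed simp

lemma block_sum_staircase:
  assumes "staircase t n a" "t \<le> n"
  shows "block_sum n a = int n * int n - int t * (int t + 1)"
proof -
  have row: "(\<Sum>j<k. if i + j < t then - 1 else 1 :: int) = int k - 2 * int (min k (t - i))" for i k
    by (induction k) auto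
  have "block_sum n a = (\<Sum>i<n. \<Sum>j<n. if i + j < t then - 1 else 1)"
    unfolding block_sum_def using assms(1) by (intro sum.cong refl) (auto simp: staircase_def)
  also have "\<dots> = (\<Sum>i<n. int n - 2 * int (t - i))"
    unfolding row using assms(2) by (intro sum.cong refl) auto
  also have "\<dots> = int n * int n - int t * (int t + 1)"
    using sum_linear_staircase[OF assms(2)] by (simp add: sum_subtractf sum_distrib_left[symmetric])
  finally show ?thesis .
qed

text \<open>
The row is the \<open>r\<close>-th one below a block of the full determined size \<open>e\<close>. As in
\<open>staircase_next_row\<close>, its entries from column \<open>t div 2 + r\<close> on agree with the entry in column \<open>0\<close>;
two of them are at distance \<open>r\<close> below a pair of \<open>1\<close>s, so they all are \<open>1\<close>. The remaining columns
are so few that any two of them at distance at least \<open>r\<close> also lie below a pair of \<open>1\<close>s. Hence all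
\<open>-1\<close>s of the row lie within \<open>r\<close> consecutive columns.
\<close>
lemma row_sum_near_staircase:
  assumes z: "zero_sum_free (Suc i) e a" and st: "staircase t e a" and e: "e = t + t div 2"
    and i: "i + 1 = e + r" "1 \<le> r" "2 * r + 1 \<le> t"
  shows "(\<Sum>j<e. a i j) \<ge> int e - 2 * int r"
proof -
  have top: "a k l = (if k + l < t then -1 else 1)" if "k < e" "l < e" for k l
    using st that by (simp add: staircase_def)
  have entry: "a i l = 1 \<or> a i l = -1" if "l < e" for l
    using zero_sum_free_entry[OF z] that by simp
  have sq: "a (i - s) l + a (i - s) (l + s) + a i l + a i (l + s) \<noteq> 0"
    if "0 < s" "s \<le> i" "l + s < e" for l s
    using zero_sum_free_square[OF z that(1), of "i - s" l] that by simp
  have eq: "a i v = a i 0" if "t div 2 + r \<le> v" "v < e" for v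
  proof -
    have "a (i - v) 0 = -1" "a (i - v) v = 1"
      using top[of "i - v" 0] top[of "i - v" v] that i e by auto
    then show ?thesis
      using sq[of v 0] entry[of 0] entry[of v] that i e by auto
  qed
  have two: "\<not> (a i l = -1 \<and> a i (l + s) = -1)" if "r \<le> s" "t + s \<le> i" "l + s < e" for l s
  proof -
    have "a (i - s) l = 1" "a (i - s) (l + s) = 1"
      using top[of "i - s" l] top[of "i - s" "l + s"] that i by auto
    then show ?thesis using sq[of s l] that i by auto
  qed
  have "\<not> (a i (e - 1 - r) = -1 \<and> a i (e - 1 - r + r) = -1)"
    by (rule two) (use i e in auto)
  moreover have "e - 1 - r + r = e - 1" using i e by auto
  moreover have "a i (e - 1 - r) = a i 0" "a i (e - 1) = a i 0"
    by (rule eq; use i e in auto)+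
  ultimately have first: "a i 0 = 1" using entry[of 0] i e by auto
  define N where "N = {j. j < e \<and> a i j = -1}"
  have fin: "finite N" by (simp add: N_def)
  have card: "card N \<le> r"
  proof (cases "N = {}")
    case False
    define M where "M = Min N"
    have M: "M \<in> N" "\<And>v. v \<in> N \<Longrightarrow> M \<le> v" using fin False by (auto simp: M_def)
    have "M \<noteq> 0" using M(1) first by (auto simp: N_def intro: ccontr)
    have "N \<subseteq> {M..<M + r}"
    proof
      fix v assume v: "v \<in> N"
      have v': "v < e" "a i v = -1" "a i M = -1" using v M(1) by (auto simp: N_def)
      have "v < t div 2 + r" using eq[of v] v' first by (cases "v < t div 2 + r") auto
      then have "t + (v - M) \<le> i" using M(2)[OF v] \<open>M \<noteq> 0\<close> i e by linarith
      then have "\<not> r \<le> v - M"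
        using two[of "v - M" M] M(2)[OF v] v' by auto
      then show "v \<in> {M..<M + r}" using M(2)[OF v] by auto
    qed
    then show ?thesis using card_mono[of "{M..<M + r}" N] by simp
  qed simp
  have "(\<Sum>j<e. a i j) = (\<Sum>j<e. 1 - 2 * of_bool (j \<in> N))"
    using entry by (intro sum.cong refl) (force simp: N_def)
  also have "\<dots> = int e - 2 * int (card N)"
  proof -
    have "{..<e} \<inter> N = N" by (auto simp: N_def)
    then show ?thesis by (simp add: sum_subtractf sum_distrib_left[symmetric])
  qed
  finally show ?thesis using card by simp
qed

text \<open>
Two cells of the row at distance \<open>s\<close> lie below two \<open>1\<close>s and so cannot both be \<open>-1\<close>. With \<open>s\<close> about
\<open>e / 2\<close> this pairs off all columns except at most one.
\<close>
lemma row_sum_by_pairing: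
  assumes z: "zero_sum_free (Suc i) e a" and st: "staircase t e a"
    and s: "i < e + s" "t + s \<le> i" "e \<le> 2 * s" "2 * s \<le> e + 1" "0 < s" "s \<le> e"
  shows "(\<Sum>j<e. a i j) \<ge> -1"
proof -
  have entry: "a i l \<ge> -1" if "l < e" for l
    using zero_sum_free_entry[OF z, of i l] that by auto
  have pair: "a i l + a i (l + s) \<ge> 0" if "l < e - s" for l
  proof -
    have l: "l < e" "l + s < e" using that s by auto
    then have "a (i - s) l = 1" "a (i - s) (l + s) = 1"
      using st s by (auto simp: staircase_def)
    then show ?thesis
      using zero_sum_free_square[OF z s(5), of "i - s" l] zero_sum_free_entry[OF z, of i l]
        zero_sum_free_entry[OF z, of i "l + s"] l s
      by auto
  qed
  have "(\<Sum>j<e. a i j) = (\<Sum>j<e - s. a i j) + (\<Sum>j=e - s..<s. a i j) + (\<Sum>j=s..<e. a i j)"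
    using s by (simp add: lessThan_atLeast0 sum.atLeastLessThan_concat)
  also have "(\<Sum>j=s..<e. a i j) = (\<Sum>j<e - s. a i (j + s))"
    using sum.shift_bounds_nat_ivl[of "a i" 0 s "e - s"] s by (simp add: lessThan_atLeast0)
  finally have "(\<Sum>j<e. a i j) = (\<Sum>j<e - s. a i j + a i (j + s)) + (\<Sum>j=e - s..<s. a i j)"
    by (simp add: sum.distrib)
  moreover have "(\<Sum>j<e - s. a i j + a i (j + s)) \<ge> 0"
    using pair by (intro sum_nonneg) auto
  moreover have "(\<Sum>j=e - s..<s. a i j) \<ge> (\<Sum>j=e - s..<s. -1)"
    using entry s by (intro sum_mono) auto
  ultimately show ?thesis using s by simp
qed

text \<open>
The rows and columns next to the block have length \<open>i\<close>, but their sums are known only over their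
first \<open>e\<close> cells. The other cells are bounded by \<open>-1\<close>.
\<close>
lemma block_sum_growth:
  assumes z: "zero_sum_free (Suc i) (Suc i) a" and "e \<le> i"
    and "(\<Sum>j<e. a i j) \<ge> S" "(\<Sum>j<e. a j i) \<ge> S"
  shows "block_sum (Suc i) a \<ge> block_sum i a + 2 * S - 2 * int (i - e) - 1"
proof -
  have part: "(\<Sum>j<i. f j) \<ge> S - int (i - e)"
    if "\<And>j. j < i \<Longrightarrow> f j \<ge> -1" "(\<Sum>j<e. f j) \<ge> S" for f :: "nat \<Rightarrow> int"
  proof -
    have "(\<Sum>j<i. f j) = (\<Sum>j<e. f j) + (\<Sum>j=e..<i. f j)"
      using assms(2) by (simp add: lessThan_atLeast0 sum.atLeastLessThan_concat)
    moreover have "(\<Sum>j=e..<i. f j) \<ge> (\<Sum>j=e..<i. -1)"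
      using that(1) by (intro sum_mono) auto
    ultimately show ?thesis using that(2) by simp
  qed
  have ge: "a k l \<ge> -1" if "k \<le> i" "l \<le> i" for k l
    using zero_sum_free_entry[OF z, of k l] that by auto
  show ?thesis
    using part[of "a i"] part[of "\<lambda>j. a j i"] ge[of i i] ge assms(3,4) unfolding block_sum_Suc
      by force
qed

text \<open>
The block of size \<open>e\<close> has a sum of order \<open>5 t\<^sup>2 / 4\<close>. The block is enlarged one row and column at a
time up to size \<open>n\<close>. In the first \<open>u = (t - 1) div 2\<close> steps the \<open>1\<close>s dominate and the sum grows; at
most two steps remain, since \<open>n \<le> 2 t + 1\<close>, and these lose only an amount linear in \<open>t\<close>.
\<close>
lemma block_sum_large_of_corner_staircase:
  assumes z: "zero_sum_free n n a" and st: "staircase t e a" and e: "e = t + t div 2"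
    and n: "e < n" "n \<le> 2 * t + 1" and t: "4 \<le> t"
  shows "block_sum n a > int n"
proof -
  have rows: "zero_sum_free (Suc i) e a" "zero_sum_free (Suc i) e (transp a)"
      "zero_sum_free (Suc i) (Suc i) a"
    if "e \<le> i" "i < n" for i
    using that zero_sum_free_shift[OF z, of 0 "Suc i" 0 e]
      zero_sum_free_transp[OF zero_sum_free_shift[OF z, of 0 e 0 "Suc i"]]
      zero_sum_free_shift[OF z, of 0 "Suc i" 0 "Suc i"] by (simp_all add: shift_def)
  have stT: "staircase t e (transp a)" using st by (simp add: staircase_transp)
  have near: "block_sum (e + r) a \<ge> block_sum (e + (r - 1)) a + 2 * int e - 6 * int r + 1"
    if r: "1 \<le> r" "2 * r + 1 \<le> t" "e + r \<le> n" for r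
  proof -
    let ?i = "e + (r - 1)"
    have i: "?i + 1 = e + r" "e \<le> ?i" "?i < n" using r by auto
    have "(\<Sum>j<e. a ?i j) \<ge> int e - 2 * int r"
      by (rule row_sum_near_staircase[OF rows(1) st e]) (use i r in auto)
    moreover have "(\<Sum>j<e. a j ?i) \<ge> int e - 2 * int r"
      using row_sum_near_staircase[OF rows(2) stT e, of ?i r] i r by (simp add: transp_def)
    ultimately show ?thesis
      using block_sum_growth[OF rows(3)[OF i(2,3)] i(2), of "int e - 2 * int r"] i r
        by (simp add: algebra_simps of_nat_diff)
  qed
  \<comment> \<open>Here the columns forced to be \<open>1\<close> may run out, so only the pairing of columns is left.\<close>
  have far: "block_sum (e + r) a \<ge> block_sum (e + (r - 1)) a - 2 * int r - 1"
    if r: "t \<le> 2 * r" "2 * r \<le> t + 3" "e + r \<le> n" for r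
  proof -
    let ?i = "e + (r - 1)" and ?s = "(e + 1) div 2"
    have i: "?i + 1 = e + r" "e \<le> ?i" "?i < n" using r t by auto
    have s: "?i < e + ?s" "t + ?s \<le> ?i" "e \<le> 2 * ?s" "2 * ?s \<le> e + 1" "0 < ?s" "?s \<le> e"
    proof -
      have "2 \<le> t div 2" "e \<le> 2 * ?s" "2 * ?s \<le> e + 1" using t by auto
      then show "?i < e + ?s" "t + ?s \<le> ?i" "e \<le> 2 * ?s" "2 * ?s \<le> e + 1" "0 < ?s" "?s \<le> e"
        using r e t i(1) by linarith+
    qed
    have "(\<Sum>j<e. a ?i j) \<ge> -1"
      by (rule row_sum_by_pairing[OF rows(1)[OF i(2,3)] st s])
    moreover have "(\<Sum>j<e. a j ?i) \<ge> -1"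
      using row_sum_by_pairing[OF rows(2)[OF i(2,3)] stT s] by (simp add: transp_def)
    ultimately show ?thesis
      using block_sum_growth[OF rows(3)[OF i(2,3)] i(2), of "-1"] i r t by (simp add: of_nat_diff)
  qed
  \<comment> \<open>Only the gain \<open>2 * e - 5\<close> of the first step is kept; the later ones gain at least \<open>3\<close>, as
      \<open>6 * r \<le> 3 * t - 3\<close> and \<open>2 * e \<ge> 3 * t - 1\<close>.\<close>
  have near': "block_sum (e + r) a \<ge> block_sum e a + 2 * int e - 5"
    if "1 \<le> r" "2 * r + 1 \<le> t" "e + r \<le> n" for r
    using that
  proof (induction r rule: dec_induct)
    case base
    then show ?case using near[of 1] by simp
  next
    case (step r)
    then show ?case using near[of "Suc r"] e by (simp; linarith)
  qed
  define u where "u = (t - 1) div 2"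
  define w where "w = n - e"
  have nw: "n = e + w" "1 \<le> w" "w \<le> u + 2" using n e t by (auto simp: w_def u_def)
  have u: "1 \<le> u" "2 * u + 1 \<le> t" "t \<le> 2 * u + 2" using t by (auto simp: u_def)
  have "block_sum n a \<ge> block_sum e a + 2 * int e - 5 - (4 * int u + 8)"
  proof -
    consider "w \<le> u" | "w = u + 1" | "w = u + 2" using nw by linarith
    then show ?thesis
    proof cases
      case 1
      then show ?thesis using near'[of w] nw u by auto
    next
      case 2
      then show ?thesis using near'[of u] far[of "u + 1"] nw u by simp
    next
      case 3
      then show ?thesis using near'[of u] far[of "u + 1"] far[of "u + 2"] nw u by simp
    qed
  qed
  moreover have "block_sum e a = int e * int e - int t * (int t + 1)"
    using block_sum_staircase[OF st] e by simp
  moreover have "int e * int e - int t * (int t + 1) + 2 * int e - 5 - (4 * int u + 8) > 2 * int t + 1"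
  proof -
    define h where "h = t div 2"
    have h: "t = 2 * h \<or> t = 2 * h + 1" "2 \<le> h" unfolding h_def using t by presburger+
    have hh: "int h * int h \<ge> 2 * int h" using h(2) by (intro mult_right_mono) auto
    let ?d = "int e * int e - int t * (int t + 1) + 2 * int e - 5 - (4 * int u + 8) - (2 * int t + 1)"
    from h(1) have "?d > 0"
    proof
      assume "t = 2 * h"
      moreover from this have "e = 3 * h" "u = h - 1" using e h u by auto
      ultimately have "?d = 5 * (int h * int h) - 4 * int h - 10"
        using h(2) by (simp add: algebra_simps of_nat_diff)
      then show ?thesis using hh h(2) by linarith
    next
      assume "t = 2 * h + 1"
      moreover from this have "e = 3 * h + 1" "u = h" using e h u by auto
      ultimately have "?d = 5 * (int h * int h) - 2 * int h - 15"
        by (simp add: algebra_simps)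
      then show ?thesis using hh h(2) by linarith
    qed
    then show ?thesis by linarith
  qed
  ultimately show ?thesis using n by linarith
qed

section \<open>From a staircase block to the whole array\<close>

text \<open>
The staircase grows from the corner up to size \<open>t + t div 2\<close>. It cannot stop short of \<open>n\<close>, because
then the sum would be too large. Once it fills the array, its sum \<open>n\<^sup>2 - t (t + 1)\<close> is at most \<open>n\<close>
only for \<open>t \<ge> n - 1\<close>.
\<close>
lemma staircase_fills:
  assumes z: "zero_sum_free n n a" and small_sum: "\<bar>block_sum n a\<bar> \<le> int n"
      and st: "staircase t m a"
    and t: "t \<in> {m - 1, m}" and m: "5 \<le> m" "m \<le> n" "n < 2 * m"
  shows "\<exists>t\<in>{n - 1, n}. staircase t n a"
proof -
  have ext: "staircase t b a" if "m \<le> b" "b \<le> n" "b \<le> t + t div 2" for b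
    using that
  proof (induction b rule: dec_induct)
    case base
    show ?case by (rule st)
  next
    case (step b)
    have "staircase t b a" using step by simp
    moreover have "zero_sum_free (Suc b) (Suc b) a"
      using zero_sum_free_shift[OF z, of 0 "Suc b" 0 "Suc b"] step by (simp add: shift_def)
    ultimately show ?case
      by (intro staircase_extend) (use step t m in auto)
  qed
  have "n \<le> t + t div 2"
  proof (rule ccontr)
    assume "\<not> n \<le> t + t div 2"
    then have "block_sum n a > int n"
      by (intro block_sum_large_of_corner_staircase[OF z ext refl]) (use t m in auto)
    then show False using small_sum by simp
  qed
  then have stn: "staircase t n a" using ext m by simp
  have tn: "t \<le> n" using t m by auto
  have "int n * int n - int t * (int t + 1) \<le> int n"
    using small_sum block_sum_staircase[OF stn tn] by simp
  moreover have "int t * (int t + 1) \<le> (int n - 2) * (int n - 1)" if "t \<le> n - 2"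
    using that m by (intro mult_mono) auto
  ultimately have "\<not> t \<le> n - 2" using m by (auto simp: algebra_simps)
  then have "t \<in> {n - 1, n}" using tn by auto
  then show ?thesis using stn by blast
qed

lemma staircase_shift_imp_staircase:
  assumes z: "zero_sum_free n n a" and small_sum: "\<bar>block_sum n a\<bar> \<le> int n"
      and st: "staircase t m (shift p q a)"
    and t: "t \<in> {m - 1, m}" and m: "5 \<le> m" "n < 2 * m" "p + m \<le> n" "q + m \<le> n"
  shows "\<exists>t\<in>{n - 1, n}. staircase t n a"
proof -
  obtain m' t' where m': "m \<le> m'" "m' \<le> n" "t' \<in> {m' - 1, m'}"
      and st': "staircase t' m' a \<or> staircase t' m' (neg (rot n a))"
    using staircase_slide_to_corner[OF z st t m(1,3,4)] by blast
  from st' show ?thesis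
  proof
    assume "staircase t' m' a"
    then show ?thesis using staircase_fills[OF z small_sum _ m'(3)] m m' by simp
  next
    assume s: "staircase t' m' (neg (rot n a))"
    obtain t where t: "t \<in> {n - 1, n}" "staircase t n (neg (rot n a))"
      using staircase_fills[OF zero_sum_free_neg[OF zero_sum_free_rot[OF z]] _ s m'(3)] small_sum m m'
      by (auto simp: block_sum_neg block_sum_rot)
    have "a i j = (if i + j < 2 * n - 1 - t then -1 else 1)" if "i < n" "j < n" for i j
    proof -
      have "neg (rot n a) (n - 1 - i) (n - 1 - j) = (if (n - 1 - i) + (n - 1 - j) < t then -1
        else 1)"
        using t(2) that by (simp add: staircase_def)
      moreover have "neg (rot n a) (n - 1 - i) (n - 1 - j) = - a i j"
        using that by (simp add: neg_def rot_def)
      ultimately show ?thesis using t(1) that by (auto split: if_splits)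
    qed
    then have "staircase (2 * n - 1 - t) n a" by (simp add: staircase_def)
    moreover have "2 * n - 1 - t \<in> {n - 1, n}" using t(1) m by auto
    ultimately show ?thesis by blast
  qed
qed

text \<open>
The symmetries of the array reduce the four forms of the block to a staircase in its top left
corner.
\<close>
lemma main_split_of_shift:
  assumes z: "zero_sum_free n n a" and small_sum: "\<bar>block_sum n a\<bar> \<le> int n"
      and ms: "main_split m (shift p q a)"
    and m: "5 \<le> m" "n < 2 * m" "p + m \<le> n" "q + m \<le> n"
  shows "main_split n a"
proof -
  have fl: "flip m (shift p q b) i j = shift p (n - m - q) (flip n b) i j" if "j < m" for b i j
  proof -
    have "q + (m - 1 - j) = n - 1 - (n - m - q + j)" using m that by simp
    then show ?thesis by (simp add: flip_def shift_def)
  qed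
  obtain t where t: "t \<in> {m - 1, m}" and cases: "staircase t m (shift p q a) \<or>
      staircase t m (neg (shift p q a)) \<or>
      staircase t m (flip m (shift p q a)) \<or> staircase t m (neg (flip m (shift p q a)))"
    using ms by (auto simp: main_split_def)
  have q: "n - m - q + m \<le> n" using m by simp
  note core = staircase_shift_imp_staircase[OF _ _ _ t m(1,2,3)]
  from cases show ?thesis
  proof (elim disjE)
    assume "staircase t m (shift p q a)"
    from core[OF z small_sum this m(4)] show ?thesis by (auto simp: main_split_def)
  next
    assume "staircase t m (neg (shift p q a))"
    then have "staircase t m (shift p q (neg a))" by (simp add: shift_def neg_def)
    from core[OF zero_sum_free_neg[OF z] _ this m(4)] show ?thesis
      using small_sum by (auto simp: main_split_def block_sum_neg)
  next
    assume "staircase t m (flip m (shift p q a))"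
    then have "staircase t m (shift p (n - m - q) (flip n a))" by (simp add: staircase_def fl)
    from core[OF zero_sum_free_flip[OF z] _ this q] show ?thesis
      using small_sum by (auto simp: main_split_def block_sum_flip)
  next
    assume "staircase t m (neg (flip m (shift p q a)))"
    then have "staircase t m (shift p (n - m - q) (neg (flip n a)))"
      by (simp add: staircase_def neg_def fl) (simp add: shift_def)
    from core[OF zero_sum_free_neg[OF zero_sum_free_flip[OF z]] _ this q] show ?thesis
      using small_sum by (auto simp: main_split_def block_sum_flip block_sum_neg)
  qed
qed

section \<open>Arrays without small blocks\<close>

lemma block_sum_shift_cart:
  "block_sum k (shift p q a) = (\<Sum>(i, j)\<in>{p..<p + k} \<times> {q..<q + k}. a i j)"
proof -
  have "(\<Sum>j<k. a i (q + j)) = (\<Sum>j=q..<q + k. a i j)" for i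
    using sum.shift_bounds_nat_ivl[of "a i" 0 q k] by (simp add: lessThan_atLeast0 add.commute)
  then have "block_sum k (shift p q a) = (\<Sum>i<k. \<Sum>j=q..<q + k. a (p + i) j)"
    by (simp add: block_sum_def shift_def)
  also have "\<dots> = (\<Sum>i=p..<p + k. \<Sum>j=q..<q + k. a i j)"
    using sum.shift_bounds_nat_ivl[of "\<lambda>i. \<Sum>j=q..<q + k. a i j" 0 p k]
    by (simp add: lessThan_atLeast0 add.commute)
  finally show ?thesis by (simp add: sum.cartesian_product)
qed

lemma block_sum_shift_ge_enclosing:
  assumes "\<And>i j. i < n \<Longrightarrow> j < n \<Longrightarrow> a i j \<le> (1::int)"
    and "p' \<le> p" "p + k \<le> p' + Suc k" "p' + Suc k \<le> n"
    and "q' \<le> q" "q + k \<le> q' + Suc k" "q' + Suc k \<le> n"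
  shows "block_sum k (shift p q a) \<ge> block_sum (Suc k) (shift p' q' a) - (2 * int k + 1)"
proof -
  let ?A = "{p'..<p' + Suc k} \<times> {q'..<q' + Suc k}" and ?B = "{p..<p + k} \<times> {q..<q + k}"
  have sub: "?B \<subseteq> ?A" using assms by auto
  have "card (?A - ?B) = Suc k * Suc k - k * k"
    using sub by (subst card_Diff_subset) auto
  then have c: "int (card (?A - ?B)) = 2 * int k + 1" by (simp add: algebra_simps)
  have "(\<Sum>(i, j)\<in>?A. a i j) = (\<Sum>(i, j)\<in>?A - ?B. a i j) + (\<Sum>(i, j)\<in>?B. a i j)"
    by (rule sum.subset_diff[OF sub]) simp
  moreover have "(\<Sum>(i, j)\<in>?A - ?B. a i j) \<le> (\<Sum>_\<in>?A - ?B. 1)"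
    using assms by (intro sum_mono) auto
  ultimately show ?thesis using c by (simp add: block_sum_shift_cart)
qed

lemma block_sum_shift_step:
  assumes "\<And>i j. i < n \<Longrightarrow> j < n \<Longrightarrow> \<bar>a i j\<bar> \<le> (1::int)"
    and "Suc p + m \<le> n" "q + m \<le> n"
  shows "block_sum m (shift (Suc p) q a) \<ge> block_sum m (shift p q a) - 2 * int m"
proof -
  define f where "f = (\<lambda>i. \<Sum>j<m. a (p + i) (q + j))"
  have f: "\<bar>f i\<bar> \<le> int m" if "i \<le> m" for i
  proof -
    have "\<bar>f i\<bar> \<le> (\<Sum>j<m. \<bar>a (p + i) (q + j)\<bar>)" unfolding f_def by (rule sum_abs)
    also have "\<dots> \<le> (\<Sum>j<m. 1)" using assms that by (intro sum_mono) auto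
    finally show ?thesis by simp
  qed
  have "(\<Sum>i<m. f (Suc i)) + f 0 = (\<Sum>i<m. f i) + f m"
    using sum.lessThan_Suc_shift[of f m] by (simp add: add.commute)
  moreover have "block_sum m (shift (Suc p) q a) = (\<Sum>i<m. f (Suc i))"
      "block_sum m (shift p q a) = (\<Sum>i<m. f i)"
    by (simp_all add: block_sum_def shift_def f_def)
  ultimately show ?thesis using f[of 0] f[of m] by simp
qed

text \<open>
A sum above \<open>m\<close> would have to drop by more than \<open>2 m\<close> to get below \<open>-m\<close>, but one step exchanges
only \<open>m\<close> entries for \<open>m\<close> others.
\<close>
lemma blocks_same_sign:
  assumes a: "\<And>i j. i < n \<Longrightarrow> j < n \<Longrightarrow> \<bar>a i j\<bar> \<le> (1::int)"
    and big: "\<And>p q. p + m \<le> n \<Longrightarrow> q + m \<le> n \<Longrightarrow> \<bar>block_sum m (shift p q a)\<bar> > int m"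
    and pos: "block_sum m (shift 0 0 a) > 0"
    and pq: "p + m \<le> n" "q + m \<le> n"
  shows "block_sum m (shift p q a) > int m"
  using pq
proof (induction p)
  case 0
  then show ?case
  proof (induction q)
    case 0
    then show ?case using big[of 0 0] pos by simp
  next
    case (Suc q)
    have tr: "block_sum m (shift x y a) = block_sum m (shift y x (transp a))" for x y
      using block_sum_transp[of m "shift x y a"] by (simp add: shift_def transp_def)
    have "block_sum m (shift 0 (Suc q) a) \<ge> block_sum m (shift 0 q a) - 2 * int m"
      unfolding tr by (rule block_sum_shift_step[of n]) (use a Suc.prems in \<open>auto simp: transp_def\<close>)
    then show ?case using Suc big[of 0 "Suc q"] by fastforce
  qed
next
  case (Suc p)
  have "block_sum m (shift (Suc p) q a) \<ge> block_sum m (shift p q a) - 2 * int m"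
    by (rule block_sum_shift_step[OF a]) (use Suc in auto)
  then show ?case using Suc big[of "Suc p" q] by fastforce
qed

lemma sum_lessThan_add: "(\<Sum>i<k + l. f i) = (\<Sum>i<k. f i) + (\<Sum>i<l. f (k + i))" for f :: "nat \<Rightarrow> int"
  by (induction l) (simp_all add: add.assoc)

lemma block_sum_quarters:
  "block_sum (k + k) a = block_sum k (shift 0 0 a) + block_sum k (shift 0 k a)
      + block_sum k (shift k 0 a) + block_sum k (shift k k a)"
  by (simp add: block_sum_def shift_def sum_lessThan_add sum.distrib)

text \<open>
The four corner blocks of size \<open>k\<close> miss the middle row and column, while those of size \<open>k + 1\<close>
cover them twice. Together they count every cell twice, except the centre, which is counted four
times.
\<close>
lemma block_sum_overlapping_quarters:
  "2 * block_sum (Suc (k + k)) a + 2 * a k k =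
     (block_sum k (shift 0 0 a) + block_sum k (shift 0 (Suc k) a) + block_sum k (shift (Suc k) 0 a)
       + block_sum k (shift (Suc k) (Suc k) a)) +
     (block_sum (Suc k) (shift 0 0 a) + block_sum (Suc k) (shift 0 k a)
       + block_sum (Suc k) (shift k 0 a) + block_sum (Suc k) (shift k k a))"
proof -
  have low: "(\<Sum>i<Suc k. f i) = (\<Sum>i<k. f i) + f k" for f :: "nat \<Rightarrow> int" by simp
  have high: "(\<Sum>i<Suc k. f (k + i)) = f k + (\<Sum>i<k. f (Suc k + i))" for f :: "nat \<Rightarrow> int"
    unfolding sum.lessThan_Suc_shift by simp
  have all: "(\<Sum>i<Suc (k + k). f i) = (\<Sum>i<k. f i) + f k + (\<Sum>i<k. f (Suc k + i))" for f :: "nat \<Rightarrow> int"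
    using sum_lessThan_add[of f "Suc k" k] by simp
  have rows: "block_sum (Suc k) (shift k q a) =
      (\<Sum>j<Suc k. a k (q + j)) + (\<Sum>i<k. \<Sum>j<Suc k. a (Suc k + i) (q + j))" for q
    unfolding block_sum_def shift_def by (rule high[of "\<lambda>i. \<Sum>j<Suc k. a i (q + j)"])
  have cols: "(\<Sum>j<Suc k. a i (k + j)) = a i k + (\<Sum>j<k. a i (Suc k + j))" for i
    by (rule high[of "a i"])
  show ?thesis
    unfolding rows unfolding block_sum_def shift_def add_0 cols all low by (simp add: sum.distrib)
qed

text \<open>
Every block of size \<open>k\<close> lies in one of size \<open>k + 1\<close>, whose sum is at least \<open>k + 2\<close>. The \<open>2 k + 1\<close>
entries in between leave a sum of at least \<open>1 - k\<close>, which \<open>small\<close> improves to \<open>k\<close>.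
\<close>
lemma block_sum_large_of_blocks_pos:
  assumes a: "\<And>i j. i < n \<Longrightarrow> j < n \<Longrightarrow> \<bar>a i j\<bar> \<le> (1::int)"
    and n: "n = k + k \<or> n = Suc (k + k)" "1 \<le> k"
    and big: "\<And>p q. p + Suc k \<le> n \<Longrightarrow> q + Suc k \<le> n \<Longrightarrow> \<bar>block_sum (Suc k) (shift p q a)\<bar> > int (Suc k)"
    and small: "\<And>p q. p + k \<le> n \<Longrightarrow> q + k \<le> n \<Longrightarrow> \<bar>block_sum k (shift p q a)\<bar> \<ge> int k"
    and pos: "block_sum (Suc k) (shift 0 0 a) > 0"
  shows "block_sum n a > int n"
proof -
  have m: "block_sum (Suc k) (shift p q a) \<ge> int k + 2" if "p + Suc k \<le> n" "q + Suc k \<le> n" for p q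
    using blocks_same_sign[OF a big pos that] by simp
  have le: "a i j \<le> 1" if "i < n" "j < n" for i j
    using a[OF that] by simp
  have k: "block_sum k (shift p q a) \<ge> int k" if pq: "p + k \<le> n" "q + k \<le> n" for p q
  proof -
    have pick: "\<exists>x'. x' \<le> x \<and> x + k \<le> x' + Suc k \<and> x' + Suc k \<le> n" if "x + k \<le> n" for x
      by (rule exI[of _ "min x (n - Suc k)"]) (use that n in auto)
    obtain p' where p': "p' \<le> p" "p + k \<le> p' + Suc k" "p' + Suc k \<le> n" using pick[OF pq(1)] by blast
    obtain q' where q': "q' \<le> q" "q + k \<le> q' + Suc k" "q' + Suc k \<le> n" using pick[OF pq(2)] by blast
    have "block_sum k (shift p q a) \<ge> block_sum (Suc k) (shift p' q' a) - (2 * int k + 1)"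
      by (rule block_sum_shift_ge_enclosing[OF le p' q'])
    then show ?thesis using m[OF p'(3) q'(3)] small[OF pq] by simp
  qed
  from n(1) show ?thesis
  proof
    assume n': "n = k + k"
    show ?thesis
      using block_sum_quarters[of k a] k[of 0 0] k[of 0 k] k[of k 0] k[of k k] n' n(2) by simp
  next
    assume n': "n = Suc (k + k)"
    have "2 * block_sum n a + 2 * a k k \<ge> 4 * int k + 4 * (int k + 2)"
      unfolding n' block_sum_overlapping_quarters
      using k[of 0 0] k[of 0 "Suc k"] k[of "Suc k" 0] k[of "Suc k" "Suc k"]
        m[of 0 0] m[of 0 k] m[of k 0] m[of k k] n' by simp
    then show ?thesis using a[of k k] n' n(2) by simp
  qed
qed

lemma block_sum_large_of_blocks:
  assumes a: "\<And>i j. i < n \<Longrightarrow> j < n \<Longrightarrow> \<bar>a i j\<bar> \<le> (1::int)"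
    and n: "n = k + k \<or> n = Suc (k + k)" "1 \<le> k"
    and big: "\<And>p q. p + Suc k \<le> n \<Longrightarrow> q + Suc k \<le> n \<Longrightarrow> \<bar>block_sum (Suc k) (shift p q a)\<bar> > int (Suc k)"
    and small: "\<And>p q. p + k \<le> n \<Longrightarrow> q + k \<le> n \<Longrightarrow> \<bar>block_sum k (shift p q a)\<bar> \<ge> int k"
  shows "\<bar>block_sum n a\<bar> > int n"
proof (cases "block_sum (Suc k) (shift 0 0 a) > 0")
  case True
  then show ?thesis using block_sum_large_of_blocks_pos[OF a n big small] by auto
next
  case False
  have shift_neg: "block_sum l (shift p q (neg a)) = - block_sum l (shift p q a)" for l p q
    using block_sum_neg[of l "shift p q a"] by (simp add: shift_def neg_def)
  have "block_sum (Suc k) (shift 0 0 (neg a)) > 0"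
    using False big[of 0 0] n by (auto simp: shift_neg)
  then have "block_sum n (neg a) > int n"
    by (intro block_sum_large_of_blocks_pos[OF _ n])
      (use a big small in \<open>auto simp: shift_neg\<close>, simp_all add: neg_def)
  then show ?thesis by (simp add: block_sum_neg)
qed

lemma abs_block_sum_main_split:
  assumes "main_split n a"
  shows "\<bar>block_sum n a\<bar> = int n"
proof -
  have "\<bar>block_sum n b\<bar> = int n" if "staircase t n b" "t \<in> {n - 1, n}" for t b
    using block_sum_staircase[OF that(1)] that(2) by (cases n) (auto simp: algebra_simps)
  then show ?thesis
    using assms
      by (auto simp: main_split_def block_sum_neg block_sum_flip)
        (metis abs_minus_cancel block_sum_neg block_sum_flip insertI1 insertI2)+
qed
section \<open>Exhaustive search\<close>

text \<open>
Entries are encoded as booleans, with \<open>True\<close> for \<open>1\<close>. The four arguments are the corners of a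
square, and the square is forbidden if exactly two of them are \<open>True\<close>. Tables with constant
patterns keep the evaluation by rewriting short.
\<close>
fun square_ok :: "bool \<Rightarrow> bool \<Rightarrow> bool \<Rightarrow> bool \<Rightarrow> bool" where
  "square_ok True True True w = True"
| "square_ok True True False w = w"
| "square_ok True False True w = w"
| "square_ok True False False w = (\<not> w)"
| "square_ok False False False w = True"
| "square_ok False False True w = (\<not> w)"
| "square_ok False True False w = (\<not> w)"
| "square_ok False True True w = w"

text \<open>
\<open>check v xs ls\<close> tests all squares whose lower right corner is a new cell with entry \<open>v\<close>. The list
\<open>xs\<close> contains the entries to the left of the cell, the nearest first. The \<open>s\<close>-th pair of lists in
\<open>ls\<close> belongs to the row at distance \<open>s\<close> above: its first list starts in the column of the new cell
and its second one \<open>s\<close> columns further left, so that the heads are the two upper corners of the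
square of side \<open>s\<close>. The recursion ends at the border of the array, when either list runs out.
\<close>
fun check :: "bool \<Rightarrow> bool list \<Rightarrow> (bool list \<times> bool list) list \<Rightarrow> bool" where
  "check v (x # xs) ((fs, bs) # ls) = (if square_ok v x (hd fs) (hd bs) then check v xs ls
      else False)"
| "check v [] ls = True"
| "check v xs [] = True"

text \<open>
Moves the pairs of lists to the next column. A row at distance \<open>s\<close> above starts to move its second
list only when there are at least \<open>s\<close> cells on the left, which is when \<open>xs\<close> has an entry for it.
\<close>
fun advance :: "bool list \<Rightarrow> (bool list \<times> bool list) list \<Rightarrow> (bool list \<times> bool list) list" where
  "advance (x # xs) ((fs, bs) # ls) = (tl fs, tl bs) # advance xs ls"
| "advance [] ((fs, bs) # ls) = (tl fs, bs) # advance [] ls"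
| "advance xs [] = []"

text \<open>
\<open>search Q n r c p m prev cur ls\<close> tests \<open>Q\<close> for all ways of filling the array row by row. There are
\<open>c\<close> cells left in the current row, \<open>r\<close> rows after it, and a supply of \<open>p\<close> entries \<open>1\<close> and \<open>m\<close>
entries \<open>-1\<close>; the bound on the sum of the array limits this supply and so prunes the search. The
lists \<open>prev\<close> and \<open>cur\<close> are the finished rows and the cells of the current row, in reverse order.
\<close>
fun search :: "(bool list list \<Rightarrow> bool) \<Rightarrow> nat \<Rightarrow> nat \<Rightarrow> nat \<Rightarrow> nat \<Rightarrow> nat \<Rightarrow>
    bool list list \<Rightarrow> bool list \<Rightarrow> (bool list \<times> bool list) list \<Rightarrow> bool" where
  "search Q n 0 0 p m prev cur ls = Q (rev cur # prev)"
| "search Q n (Suc r) 0 p m prev cur ls =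
     (let rs = rev cur # prev in search Q n r n p m rs [] (map (\<lambda>x. (x, x)) rs))"
| "search Q n r (Suc c) p m prev cur ls =
     (let ls' = advance cur ls in
      if (case p of 0 \<Rightarrow> True
          | Suc p' \<Rightarrow> if check True cur ls then search Q n r c p' m prev (True # cur) ls' else True)
      then (case m of 0 \<Rightarrow> True
          | Suc m' \<Rightarrow> if check False cur ls then search Q n r c p m' prev (False # cur) ls'
            else True)
      else False)"

lemma check_iff:
  "check v xs ls \<longleftrightarrow>
    (\<forall>k<min (length xs) (length ls). square_ok v (xs ! k) (hd (fst (ls ! k))) (hd (snd (ls ! k))))"
proof (induction v xs ls rule: check.induct)
  case (1 v x xs fs bs ls)
  then show ?case
    by (auto simp: less_Suc_eq_0_disj)
qed auto

lemma length_advance: "length (advance xs ls) = length ls"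
  by (induction xs ls rule: advance.induct) auto

lemma nth_advance:
  "k < length ls \<Longrightarrow>
   advance xs ls ! k = (tl (fst (ls ! k)), (if k < length xs then tl else id) (snd (ls ! k)))"
  by (induction xs ls arbitrary: k rule: advance.induct) (auto simp: nth_Cons split: nat.splits)

definition row_lists :: "(nat \<Rightarrow> nat \<Rightarrow> bool) \<Rightarrow> nat \<Rightarrow> nat \<Rightarrow> bool list list" where
  "row_lists A n i = map (\<lambda>k. map (A k) [0..<n]) (rev [0..<i])"

text \<open>
The pairs of lists that accompany the cell \<open>(i, j)\<close>. The truncated subtraction \<open>j - Suc s\<close>
expresses that the second list waits in column \<open>0\<close> as long as \<open>j \<le> s\<close>.
\<close>
definition lanes :: "(nat \<Rightarrow> nat \<Rightarrow> bool) \<Rightarrow> nat \<Rightarrow> nat \<Rightarrow> nat \<Rightarrow> (bool list \<times> bool list) list" where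
  "lanes A n i j =
      map (\<lambda>s. (map (A (i - Suc s)) [j..<n], map (A (i - Suc s)) [j - Suc s..<n])) [0..<i]"

definition remaining :: "(nat \<Rightarrow> nat \<Rightarrow> bool) \<Rightarrow> nat \<Rightarrow> nat \<Rightarrow> nat \<Rightarrow> nat \<Rightarrow> nat" where
  "remaining A n R i j = (\<Sum>l=j..<n. of_bool (A i l)) + (\<Sum>k=Suc i..<R. \<Sum>l<n. of_bool (A k l))"

lemma row_lists_Suc: "row_lists A n (Suc i) = map (A i) [0..<n] # row_lists A n i"
  by (simp add: row_lists_def)

lemma lanes_start: "lanes A n i 0 = map (\<lambda>x. (x, x)) (row_lists A n i)"
  by (rule nth_equalityI) (auto simp: lanes_def row_lists_def rev_nth)

lemma advance_lanes:
  assumes "j < n"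
  shows "advance (map (A i) (rev [0..<j])) (lanes A n i j) = lanes A n i (Suc j)"
proof (rule nth_equalityI)
  show "length (advance (map (A i) (rev [0..<j])) (lanes A n i j)) = length (lanes A n i (Suc j))"
    by (simp add: length_advance lanes_def)
  fix k assume "k < length (advance (map (A i) (rev [0..<j])) (lanes A n i j))"
  then have k: "k < i"
    by (simp add: length_advance lanes_def)
  have "j - Suc k < n" using assms by simp
  then show "advance (map (A i) (rev [0..<j])) (lanes A n i j) ! k = lanes A n i (Suc j) ! k"
    using k assms
    by (auto simp: nth_advance lanes_def map_tl[symmetric] Suc_diff_Suc tl_upt)
qed

lemma remaining_cell:
  "j < n \<Longrightarrow> remaining A n R i j = of_bool (A i j) + remaining A n R i (Suc j)"
  unfolding remaining_def
  by (subst sum.atLeast_Suc_lessThan) (simp_all del: sum_of_bool_eq sum_of_bool_mult_eq)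

lemma remaining_row:
  "Suc i < R \<Longrightarrow> remaining A n R i n = remaining A n R (Suc i) 0"
  by (simp add: remaining_def sum.atLeast_Suc_lessThan lessThan_atLeast0)

text \<open>
An array without forbidden squares that stays within the supply survives every test on its way
through the search, so \<open>Q\<close> is evaluated on its list of rows.
\<close>
lemma search_sound:
  assumes "search Q n r c p m prev cur ls"
    and "i + Suc r = R" "j + c = n"
    and "prev = row_lists A n i" "cur = map (A i) (rev [0..<j])" "ls = lanes A n i j"
    and "remaining A n R i j \<le> p" "remaining (\<lambda>i j. \<not> A i j) n R i j \<le> m"
    and A: "\<And>i j s. 0 < s \<Longrightarrow> i + s < R \<Longrightarrow> j + s < n \<Longrightarrow>
              square_ok (A (i + s) (j + s)) (A (i + s) j) (A i (j + s)) (A i j)"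
  shows "Q (row_lists A n R)"
  using assms
proof (induction Q n r c p m prev cur ls arbitrary: i j rule: search.induct)
  case (1 Q n p m prev cur ls)
  have "rev cur # prev = row_lists A n R"
    using 1 by (auto simp: row_lists_Suc rev_map)
  then show ?case using 1 by simp
next
  case (2 Q n r p m prev cur ls)
  have rs: "rev cur # prev = row_lists A n (Suc i)"
    using 2 by (simp add: row_lists_Suc rev_map)
  show ?case
  proof (rule "2.IH"[OF refl, of "Suc i" 0])
    show "search Q n r n p m (rev cur # prev) [] (map (\<lambda>x. (x, x)) (rev cur # prev))"
      using "2.prems"(1) by (simp add: Let_def)
    show "map (\<lambda>x. (x, x)) (rev cur # prev) = lanes A n (Suc i) 0"
      by (simp add: rs lanes_start)
  qed (use "2.prems" rs remaining_row[of i R] in auto)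
next
  case (3 Q n r c p m prev cur ls)
  have jn: "j < n" using "3.prems" by simp
  have ls': "advance cur ls = lanes A n i (Suc j)"
    using "3.prems" advance_lanes[OF jn] by simp
  have chk: "check (A i j) cur ls"
    unfolding check_iff
  proof (intro allI impI)
    fix k assume "k < min (length cur) (length ls)"
    then have k: "k < j" "k < i" using "3.prems" by (auto simp: lanes_def)
    have jk: "j - Suc k + Suc k = j" and ik: "i - Suc k + Suc k = i" using k by simp_all
    have "square_ok (A i j) (A i (j - Suc k)) (A (i - Suc k) j) (A (i - Suc k) (j - Suc k))"
      by (rule "3.prems"(9)[of "Suc k" "i - Suc k" "j - Suc k", unfolded jk ik])
        (use jn "3.prems"(2) in simp_all)
    moreover have "hd (fst (ls ! k)) = A (i - Suc k) j"
      "hd (snd (ls ! k)) = A (i - Suc k) (j - Suc k)"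
      using k jn "3.prems"(6) by (simp_all add: lanes_def hd_map)
    moreover have "cur ! k = A i (j - Suc k)"
      using k "3.prems"(5) by (simp add: rev_nth)
    ultimately show "square_ok (A i j) (cur ! k) (hd (fst (ls ! k))) (hd (snd (ls ! k)))"
      by simp
  qed
  note rem = remaining_cell[OF jn, of A R i] remaining_cell[OF jn, of "\<lambda>i j. \<not> A i j" R i]
  have cur': "A i j # cur = map (A i) (rev [0..<Suc j])" using "3.prems" by simp
  show ?case
  proof (cases "A i j")
    case True
    then obtain p' where p: "p = Suc p'" using rem "3.prems" by (cases p) auto
    show ?thesis
    proof (rule "3.IH"(1)[OF refl p, of i "Suc j"])
      show "check True cur ls" using chk True by simp
      show "search Q n r c p' m prev (True # cur) (advance cur ls)"
        using "3.prems"(1) chk True p by (simp add: Let_def split: if_splits)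
    qed (use "3.prems" rem True p cur' ls' in auto)
  next
    case False
    then obtain m' where m: "m = Suc m'" using rem "3.prems" by (cases m) auto
    show ?thesis
    proof (rule "3.IH"(2)[OF refl _ m, of i "Suc j"])
      show "check False cur ls" using chk False by simp
      show "search Q n r c p m' prev (False # cur) (advance cur ls)"
        using "3.prems"(1) chk False m by (simp add: Let_def split: if_splits)
      show "case p of 0 \<Rightarrow> True
          | Suc p' \<Rightarrow> if check True cur ls then search Q n r c p' m prev (True # cur) (advance cur ls) else True"
        using "3.prems"(1) by (auto simp: Let_def split: if_splits nat.splits)
    qed (use "3.prems" rem False m cur' ls' in auto)
  qed
qed

lemma zero_sum_free_square_ok:
  assumes "zero_sum_free R C a" "0 < s" "i + s < R" "j + s < C"
  shows "square_ok (a (i + s) (j + s) = 1) (a (i + s) j = 1) (a i (j + s) = 1) (a i j = 1)"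
proof -
  have "a i j = 1 \<or> a i j = -1" "a i (j + s) = 1 \<or> a i (j + s) = -1"
    "a (i + s) j = 1 \<or> a (i + s) j = -1" "a (i + s) (j + s) = 1 \<or> a (i + s) (j + s) = -1"
    using assms by (simp_all add: zero_sum_free_entry)
  moreover have "a i j + a i (j + s) + a (i + s) j + a (i + s) (j + s) \<noteq> 0"
    using assms by (auto simp: zero_sum_free_def)
  ultimately show ?thesis
    by (elim disjE) simp_all
qed

lemma zero_sum_free_search:
  assumes "zero_sum_free (Suc r) n a" "search Q n r n p m [] [] []"
    and "(\<Sum>i<Suc r. \<Sum>j<n. of_bool (a i j = 1)) \<le> p"
    and "(\<Sum>i<Suc r. \<Sum>j<n. of_bool (a i j \<noteq> 1)) \<le> m"
  shows "Q (row_lists (\<lambda>i j. a i j = 1) n (Suc r))"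
proof (rule search_sound[OF assms(2), where i = 0 and j = 0])
  have rem: "remaining A n (Suc r) 0 0 = (\<Sum>i<Suc r. \<Sum>j<n. of_bool (A i j))" for A
    unfolding remaining_def lessThan_atLeast0
    by (subst sum.atLeast_Suc_lessThan[of 0 "Suc r"]) (simp_all del: sum_of_bool_eq)
  show "remaining (\<lambda>i j. a i j = 1) n (Suc r) 0 0 \<le> p"
    "remaining (\<lambda>i j. a i j \<noteq> 1) n (Suc r) 0 0 \<le> m"
    using assms(3,4) by (simp_all only: rem)
qed (use zero_sum_free_square_ok[OF assms(1)] in \<open>auto simp: row_lists_def lanes_def\<close>)

lemma count_entries:
  assumes "\<forall>i<R. \<forall>j<C. a i j = 1 \<or> a i j = (-1::int)"
  shows "(\<Sum>i<R. \<Sum>j<C. a i j) = 2 * int (\<Sum>i<R. \<Sum>j<C. of_bool (a i j = 1)) - int (R * C)"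
    and "(\<Sum>i<R. \<Sum>j<C. a i j) = int (R * C) - 2 * int (\<Sum>i<R. \<Sum>j<C. of_bool (a i j \<noteq> 1))"
proof -
  have "(\<Sum>i<R. \<Sum>j<C. a i j) = (\<Sum>i<R. \<Sum>j<C. 2 * int (of_bool (a i j = 1)) - 1)"
    using assms by (intro sum.cong refl) auto
  then show "(\<Sum>i<R. \<Sum>j<C. a i j) = 2 * int (\<Sum>i<R. \<Sum>j<C. of_bool (a i j = 1)) - int (R * C)"
    by (simp add: sum_subtractf sum_distrib_left of_nat_sum del: sum_of_bool_eq of_nat_of_bool)
  have "(\<Sum>i<R. \<Sum>j<C. a i j) = (\<Sum>i<R. \<Sum>j<C. 1 - 2 * int (of_bool (a i j \<noteq> 1)))"
    using assms by (intro sum.cong refl) auto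
  then show "(\<Sum>i<R. \<Sum>j<C. a i j) = int (R * C) - 2 * int (\<Sum>i<R. \<Sum>j<C. of_bool (a i j \<noteq> 1))"
    by (simp add: sum_subtractf sum_distrib_left of_nat_sum del: sum_of_bool_eq of_nat_of_bool)
qed

text \<open>
The eight arrays of \<open>main_split n\<close>, written with comparisons of \<open>i\<close> and \<open>j\<close> that need no
subtraction.
\<close>
definition main_split_leaf :: "nat \<Rightarrow> bool list list \<Rightarrow> bool" where
  "main_split_leaf n rs \<longleftrightarrow>
      rs \<in> set (concat (map (\<lambda>f. [row_lists f n n, row_lists (\<lambda>i j. \<not> f i j) n n])
     [\<lambda>i j. Suc (i + j) < n, \<lambda>i j. i + j < n, \<lambda>i j. i < j, \<lambda>i j. i \<le> j]))"

lemma row_lists_eq_iff: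
  "row_lists A n k = row_lists B n k \<longleftrightarrow> (\<forall>i<k. \<forall>j<n. A i j = B i j)"
  by (auto simp: row_lists_def)

lemma main_split_leafD:
  assumes "zero_sum_free n n a" "main_split_leaf n (row_lists (\<lambda>i j. a i j = 1) n n)" "0 < n"
  shows "main_split n a"
proof -
  have a: "a i j = (if a i j = 1 then 1 else -1)" if "i < n" "j < n" for i j
    using assms(1) that by (auto simp: zero_sum_free_def)
  have f: "flip n a i j = (if a i (n - 1 - j) = 1 then 1 else -1)" if "i < n" "j < n" for i j
    using a[of i "n - 1 - j"] that by (simp add: flip_def)
  have staircaseI: "staircase t n b" if "\<And>i j. i < n \<Longrightarrow> j < n \<Longrightarrow> b i j = (if i + j < t then -1
      else 1)" for t b
    using that by (simp add: staircase_def)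
  consider 
     (1) "\<forall>i<n. \<forall>j<n. (a i j = 1) = (Suc (i + j) < n)" | (2) "\<forall>i<n. \<forall>j<n. (a i j = 1) = (i + j < n)"
   | (3) "\<forall>i<n. \<forall>j<n. (a i j = 1) = (i < j)" | (4) "\<forall>i<n. \<forall>j<n. (a i j = 1) = (i \<le> j)"
   | (5) "\<forall>i<n. \<forall>j<n. (a i j = 1) = (\<not> Suc (i + j) < n)" | (6) "\<forall>i<n. \<forall>j<n. (a i j = 1) =
       (\<not> i + j < n)"
   | (7) "\<forall>i<n. \<forall>j<n. (a i j = 1) = (\<not> i < j)" | (8) "\<forall>i<n. \<forall>j<n. (a i j = 1) = (\<not> i \<le> j)"
    using assms(2) by (auto simp: main_split_leaf_def row_lists_eq_iff)
  then show ?thesis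
  proof cases
    case 1
    then have "staircase (n - 1) n (neg a)" by (intro staircaseI) (subst neg_def, subst a, auto)
    then show ?thesis by (auto simp: main_split_def)
  next
    case 2
    then have "staircase n n (neg a)" by (intro staircaseI) (subst neg_def, subst a, auto)
    then show ?thesis by (auto simp: main_split_def)
  next
    case 3
    then have "staircase (n - 1) n (neg (flip n a))"
      by (intro staircaseI) (subst neg_def, subst f, auto)
    then show ?thesis by (auto simp: main_split_def)
  next
    case 4
    then have "staircase n n (neg (flip n a))" by (intro staircaseI) (subst neg_def, subst f, auto)
    then show ?thesis by (auto simp: main_split_def)
  next
    case 5
    then have "staircase (n - 1) n a" by (intro staircaseI) (subst a, auto)
    then show ?thesis by (auto simp: main_split_def)
  next
    case 6
    then have "staircase n n a" by (intro staircaseI) (subst a, auto)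
    then show ?thesis by (auto simp: main_split_def)
  next
    case 7
    then have "staircase (n - 1) n (flip n a)" by (intro staircaseI) (subst f, auto)
    then show ?thesis by (auto simp: main_split_def)
  next
    case 8
    then have "staircase n n (flip n a)" by (intro staircaseI) (subst f, auto)
    then show ?thesis by (auto simp: main_split_def)
  qed
qed

text \<open>
An array with \<open>n\<^sup>2\<close> entries and \<open>\<bar>block_sum n a\<bar> \<le> n\<close> has at most \<open>(n\<^sup>2 + n) / 2\<close> entries of each
sign, which is the supply \<open>p\<close>.
\<close>
lemma main_split_by_search:
  assumes "search (main_split_leaf (Suc r)) (Suc r) r (Suc r) p p [] [] []"
    and "Suc r * Suc r + Suc r \<le> 2 * p + 1"
    and "zero_sum_free (Suc r) (Suc r) a" "\<bar>block_sum (Suc r) a\<bar> \<le> int (Suc r)"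
  shows "main_split (Suc r) a"
proof (rule main_split_leafD[OF assms(3) zero_sum_free_search[OF assms(3,1)]])
  have "\<forall>i<Suc r. \<forall>j<Suc r. a i j = 1 \<or> a i j = -1"
    using assms(3) unfolding zero_sum_free_def by blast
  note c = count_entries[OF this, folded block_sum_def]
  have p: "int (Suc r * Suc r) + int (Suc r) \<le> 2 * int p + 1" using assms(2) by linarith
  show "(\<Sum>i<Suc r. \<Sum>j<Suc r. of_bool (a i j = 1)) \<le> p"
    using c(1) assms(4) p by linarith
  show "(\<Sum>i<Suc r. \<Sum>j<Suc r. of_bool (a i j \<noteq> 1)) \<le> p"
    using c(2) assms(4) p by linarith
qed simp

lemma search_5: "search (main_split_leaf 5) 5 4 5 15 15 [] [] []" by code_simp

text \<open>
The rows are listed from the last one upwards, so that \<open>tl\<close> leaves the \<open>4 \<times> 4\<close> block above the last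
row. Its sum is at least \<open>4\<close> in absolute value if the number of its \<open>1\<close>s is not \<open>7\<close>, \<open>8\<close> or \<open>9\<close>.
\<close>
definition block_sum_4_leaf :: "bool list list \<Rightarrow> bool" where
  "block_sum_4_leaf rs = (let l = length (filter (\<lambda>x. x) (concat (tl rs))) in l < 7 \<or> 9 < l)"

lemma search_4: "search block_sum_4_leaf 4 4 4 20 20 [] [] []" by code_simp

lemma abs_block_sum_4_ge:
  assumes "zero_sum_free 5 4 a"
  shows "\<bar>block_sum 4 a\<bar> \<ge> 4"
proof -
  have le: "(\<Sum>i<Suc 4. \<Sum>j<4. of_bool (A i j)) \<le> (20::nat)" for A :: "nat \<Rightarrow> nat \<Rightarrow> bool"
  proof -
    have "(\<Sum>i<Suc 4. \<Sum>j<4. of_bool (A i j)) \<le> (\<Sum>i<Suc 4. \<Sum>j<4::nat. 1::nat)"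
      by (intro sum_mono) (simp del: sum_of_bool_eq)
    then show ?thesis by simp
  qed
  have "block_sum_4_leaf (row_lists (\<lambda>i j. a i j = 1) 4 (Suc 4))"
    by (rule zero_sum_free_search[OF _ search_4]) (use assms le in simp_all)
  then have l: "length (filter (\<lambda>x. x) (concat (row_lists (\<lambda>i j. a i j = 1) 4 4))) \<notin> {7..9}"
    unfolding block_sum_4_leaf_def row_lists_Suc Let_def list.sel by auto
  have fl: "length (filter (\<lambda>x. x) (map A [0..<k])) = (\<Sum>j<k. of_bool (A j))" for A k
    by (induction k) auto
  have "length (filter (\<lambda>x. x) (concat (row_lists A 4 k))) = (\<Sum>i<k. \<Sum>j<4. of_bool (A i j))" for A k
  proof (induction k)
    case (Suc k)
    then show ?case
      by (simp only: row_lists_Suc concat.simps filter_append length_append fl sum.lessThan_Suc add.commute)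
  qed (simp add: row_lists_def)
  then have N: "(\<Sum>i<4. \<Sum>j<4. of_bool (a i j = 1)) \<notin> {7..9::nat}"
    using l by metis
  have "\<forall>i<4. \<forall>j<4. a i j = 1 \<or> a i j = -1"
    using assms unfolding zero_sum_free_def by simp
  note c = count_entries(1)[OF this, folded block_sum_def]
  define N :: nat where "N = (\<Sum>i<4. \<Sum>j<4. of_bool (a i j = 1))"
  have "block_sum 4 a = 2 * int N - 16" "N \<notin> {7..9}"
    using c N by (simp_all only: N_def) simp
  then show ?thesis by auto
qed

lemma search_6: "search (main_split_leaf 6) 6 5 6 21 21 [] [] []" by code_simp

lemma search_7: "search (main_split_leaf 7) 7 6 7 28 28 [] [] []" by code_simp

lemma main_split_small:
  assumes "n \<in> {5, 6, 7}" "zero_sum_free n n a" "\<bar>block_sum n a\<bar> \<le> int n"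
  shows "main_split n a"
  using assms main_split_by_search[of 4 15 a] main_split_by_search[of 5 21 a]
    main_split_by_search[of 6 28 a] search_5 search_6 search_7
  by auto

section \<open>The theorem\<close>

text \<open>
A block at the bottom of the array has no fifth row below it, but one above it; an upside-down copy
reduces this to the first case.
\<close>
lemma abs_block_sum_4_shift_ge:
  assumes z: "zero_sum_free n n a" and pq: "p + 4 \<le> n" "q + 4 \<le> n" and n: "5 \<le> n"
  shows "\<bar>block_sum 4 (shift p q a)\<bar> \<ge> 4"
proof (cases "p + 5 \<le> n")
  case True
  then show ?thesis using abs_block_sum_4_ge[OF zero_sum_free_shift[OF z]] pq by simp
next
  case False
  define b where "b = transp (flip 5 (transp (shift (p - 1) q a)))"
  have "zero_sum_free 5 4 b"
    unfolding b_def
      by (intro zero_sum_free_transp zero_sum_free_flip zero_sum_free_shift[OF z]) (use False n pq in auto)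
  moreover have "block_sum 4 b = block_sum 4 (transp (flip 4 (transp (shift p q a))))"
  proof (rule block_sum_cong)
    fix i j :: nat assume "i < 4"
    then have "p - 1 + (5 - 1 - i) = p + (4 - 1 - i)" using False n by simp
    then show "b i j = transp (flip 4 (transp (shift p q a))) i j"
      by (simp add: b_def transp_def flip_def shift_def)
  qed
  ultimately show ?thesis
    using abs_block_sum_4_ge[of b] by (simp add: block_sum_transp block_sum_flip)
qed

theorem main_split_if_small_block_sum:
  assumes "5 \<le> n" "zero_sum_free n n a" "\<bar>block_sum n a\<bar> \<le> int n"
  shows "main_split n a"
  using assms
proof (induction n arbitrary: a rule: less_induct)
  case (less n)
  note z = less.prems(2)
  show ?case
  proof (cases "n \<le> 7")
    case True
    then have "n \<in> {5, 6, 7}" using less.prems(1) by auto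
    then show ?thesis using main_split_small less.prems by blast
  next
    case False
    define k where "k = n div 2"
    have k: "n = k + k \<or> n = Suc (k + k)" "4 \<le> k" "Suc k < n" "n < 2 * Suc k"
      using False unfolding k_def by presburger+
    have small: "\<bar>block_sum k (shift p q a)\<bar> \<ge> int k" if pq: "p + k \<le> n" "q + k \<le> n" for p q
    proof (cases "k = 4")
      case True
      then show ?thesis using abs_block_sum_4_shift_ge[OF z] pq less.prems(1) by simp
    next
      case False
      then have "main_split k (shift p q a)" if "\<bar>block_sum k (shift p q a)\<bar> \<le> int k"
        using less.IH[of k "shift p q a"] zero_sum_free_shift[OF z pq] that k by simp
      then show ?thesis using abs_block_sum_main_split by fastforce
    qed
    have "\<exists>p q. p + Suc k \<le> n \<and> q + Suc k \<le> n \<and> \<bar>block_sum (Suc k) (shift p q a)\<bar> \<le> int (Suc k)"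
    proof (rule ccontr)
      assume no: "\<not> ?thesis"
      have "\<bar>block_sum n a\<bar> > int n"
      proof (rule block_sum_large_of_blocks[OF _ k(1)])
        show "\<bar>a i j\<bar> \<le> 1" if "i < n" "j < n" for i j
          using zero_sum_free_entry[OF z that] by auto
        show "\<bar>block_sum (Suc k) (shift p q a)\<bar> > int (Suc k)" if "p + Suc k \<le> n" "q + Suc k \<le> n"
          for p q
          using no that by (meson not_le)
      qed (use k small in auto)
      then show False using less.prems(3) by simp
    qed
    then obtain p q where pq: "p + Suc k \<le> n" "q + Suc k \<le> n"
      and "\<bar>block_sum (Suc k) (shift p q a)\<bar> \<le> int (Suc k)" by blast
    then have "main_split (Suc k) (shift p q a)"
      by (intro less.IH zero_sum_free_shift[OF z]) (use k in auto)
    then show ?thesis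
      by (rule main_split_of_shift[OF z less.prems(3)]) (use k pq in auto)
  qed
qed

lemma zero_sum_free_of_mat:
  assumes "M \<in> carrier_mat n n" "binary_mat M" "\<not> has_zero_sum_square M"
  shows "zero_sum_free n n (\<lambda>i j. M $$ (i, j))"
proof (rule zero_sum_freeI)
  fix i j assume "i < n" "j < n"
  then have "M $$ (i, j) \<in> elements_mat M" using assms(1) by (intro elements_matI) auto
  then show "M $$ (i, j) = 1 \<or> M $$ (i, j) = -1" using assms(2) by (auto simp: binary_mat_def)
next
  fix i j s assume "0 < s" "i + s < n" "j + s < n"
  then show "M $$ (i, j) + M $$ (i, j + s) + M $$ (i + s, j) + M $$ (i + s, j + s) \<noteq> 0"
    using assms(1,3) by (auto simp: has_zero_sum_square_def)
qed

lemma disc_eq_block_sum: "M \<in> carrier_mat n n \<Longrightarrow> disc M = block_sum n (\<lambda>i j. M $$ (i, j))"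
  by (auto simp: disc_def sum_mat_def block_sum_def sum.cartesian_product lessThan_atLeast0 case_prod_unfold)

lemma split_binary_mat_of_main_split:
  assumes M: "M \<in> carrier_mat n n" and n: "0 < n" and ms: "main_split n (\<lambda>i j. M $$ (i, j))"
  shows "split_binary_mat M"
proof -
  have t_splitI: "t_split t A"
    if "A \<in> carrier_mat n n" "staircase t n (\<lambda>i j. A $$ (i, j))" "t \<in> {n - 1, n}"
      for t and A :: "int mat"
    using that n by (auto simp: t_split_def staircase_def)
  have staircase_cong: "staircase t n b" if "staircase t n c" "\<And>i j. i < n \<Longrightarrow> j < n \<Longrightarrow> b i j = c i j"
      for t b c
    using that by (simp add: staircase_def)
  obtain t where t: "t \<in> {n - 1, n}"
    and cases: "staircase t n (\<lambda>i j. M $$ (i, j)) \<or> staircase t n (neg (\<lambda>i j. M $$ (i, j))) \<or>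
      staircase t n (flip n (\<lambda>i j. M $$ (i, j))) \<or> staircase t n (neg (flip n (\<lambda>i j. M $$ (i, j))))"
    using ms unfolding main_split_def by blast
  from cases show ?thesis
  proof (elim disjE)
    assume "staircase t n (\<lambda>i j. M $$ (i, j))"
    then have "t_split t M" using t_splitI M t by blast
    then show ?thesis by (auto simp: split_binary_mat_def)
  next
    assume "staircase t n (neg (\<lambda>i j. M $$ (i, j)))"
    then have "staircase t n (\<lambda>i j. (- M) $$ (i, j))"
      by (rule staircase_cong) (use M in \<open>auto simp: neg_def\<close>)
    then have "t_split t (- M)" using M t by (intro t_splitI) auto
    then show ?thesis by (auto simp: split_binary_mat_def)
  next
    assume "staircase t n (flip n (\<lambda>i j. M $$ (i, j)))"
    then have "staircase t n (\<lambda>i j. horizontal_reflection M $$ (i, j))"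
      by (rule staircase_cong) (use M in \<open>auto simp: horizontal_reflection_def flip_def\<close>)
    then have "t_split t (horizontal_reflection M)"
      using M t by (intro t_splitI) (auto simp: horizontal_reflection_def)
    then show ?thesis by (auto simp: split_binary_mat_def)
  next
    assume s: "staircase t n (neg (flip n (\<lambda>i j. M $$ (i, j))))"
    have "M $$ (n - 1 - i, j) = (if i + j < 2 * n - 1 - t then -1 else 1)" if "i < n" "j < n"
      for i j
    proof -
      have "neg (flip n (\<lambda>i j. M $$ (i, j))) (n - 1 - i) (n - 1 - j) =
          (if (n - 1 - i) + (n - 1 - j) < t then -1 else 1)"
        using s that by (simp add: staircase_def)
      moreover have "neg (flip n (\<lambda>i j. M $$ (i, j))) (n - 1 - i) (n - 1 - j) =
        - M $$ (n - 1 - i, j)"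
        using that by (simp add: neg_def flip_def)
      ultimately show ?thesis using t that by (auto split: if_splits)
    qed
    then have "staircase (2 * n - 1 - t) n (\<lambda>i j. vertical_reflection M $$ (i, j))"
      using M by (auto simp: staircase_def vertical_reflection_def)
    moreover have "2 * n - 1 - t \<in> {n - 1, n}" using t n by auto
    ultimately have "t_split (2 * n - 1 - t) (vertical_reflection M)"
      using M by (intro t_splitI) (auto simp: vertical_reflection_def)
    then show ?thesis by (auto simp: split_binary_mat_def)
  qed
qed

theorem theorem2:
  fixes n :: nat
  assumes "n \<ge> 5"
  shows "(\<forall>M \<in> carrier_mat n n. binary_mat M \<and> \<not> split_binary_mat M \<and> \<bar>disc M\<bar> \<le> int n
            \<longrightarrow> has_zero_sum_square M) \<and>
         (\<forall>M \<in> carrier_mat n n. binary_mat M \<and> disc M = 0 \<longrightarrow> has_zero_sum_square M)"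
proof -
  have ms: "main_split n (\<lambda>i j. M $$ (i, j))"
    if "M \<in> carrier_mat n n" "binary_mat M" "\<not> has_zero_sum_square M" "\<bar>disc M\<bar> \<le> int n" for M
    using main_split_if_small_block_sum[OF assms zero_sum_free_of_mat] disc_eq_block_sum that by simp
  show ?thesis
  proof (intro conjI ballI impI; rule ccontr)
    fix M assume "M \<in> carrier_mat n n" "binary_mat M \<and> \<not> split_binary_mat M \<and> \<bar>disc M\<bar> \<le> int n"
      "\<not> has_zero_sum_square M"
    then show False using ms split_binary_mat_of_main_split assms by fastforce
  next
    fix M assume M: "M \<in> carrier_mat n n" "binary_mat M \<and> disc M = 0" "\<not> has_zero_sum_square M"
    then have "main_split n (\<lambda>i j. M $$ (i, j))" by (intro ms) auto
    from abs_block_sum_main_split[OF this] show False using M disc_eq_block_sum[OF M(1)] assms by simp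
  qed
qed

end
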